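(* For every even integer $n\geq 6$, $\Pi^{bichrom}(n)\geq \left\lceil \frac{n-2}{72}\right\rceil$. That is, for every simple polygon $P$ and every set $S$ in general position in $P$ of $n/2$ red and $n/2$ blue points, there exist a red point $r$ and a blue point $b$ of $S$ such that every geodesic disk through $r$ and $b$ contains at least $\left\lceil \frac{n-2}{72}\right\rceil$ points of $S$.
   Context: $P$ is a simple polygon (a closed region). For $a,b\in P$, $g(a,b)$ denotes the shortest (geodesic) path from $a$ to $b$ inside $P$ and $|g(a,b)|$ its length. A geodesic disk with center $c$ and radius $r$ is $D(c,r)=\{x\in P:|g(c,x)|\le r\}$; it is "through" some points if those points lie on its boundary (distance exactly $r$ from $c$), and contains a point if the point belongs to it. General position of $S$: no three points of $S$ are geodesically collinear (one on the geodesic path between the other two), no four points among $S$ and the vertices of $P$ lie on the boundary of a common geodesic disk, there are no $x,y\in S$ and reflex vertex $p$ of $P$ with $y\in g(x,p)$, and no geodesic bisector of two points of $S$ passes through a vertex of $P$. $\Pi^{bichrom}(n)$ is the largest integer such that for every simple polygon $P$ and every such set $S$ of $n/2$ red and $n/2$ blue points, there exist a red point $r$ and a blue point $b$ such that every geodesic disk through them contains at least $\Pi^{bichrom}(n)$ points of $S$. *)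

theory Defs
  imports "HOL-Analysis.Analysis"
begin

definition partition_sums :: "(real \<Rightarrow> complex) \<Rightarrow> real set" where
  "partition_sums \<gamma> =
     {(\<Sum>i<length ts - 1. dist (\<gamma> (ts ! Suc i)) (\<gamma> (ts ! i))) | ts.
        ts \<noteq> [] \<and> sorted ts \<and> hd ts = 0 \<and> last ts = 1}"

definition rectifiable :: "(real \<Rightarrow> complex) \<Rightarrow> bool" where
  "rectifiable \<gamma> \<longleftrightarrow> bdd_above (partition_sums \<gamma>)"

definition path_length :: "(real \<Rightarrow> complex) \<Rightarrow> real" where
  "path_length \<gamma> = Sup (partition_sums \<gamma>)"

fun polyline :: "complex list \<Rightarrow> real \<Rightarrow> complex" where
  "polyline [] = linepath 0 0"
| "polyline [a] = linepath a a"
| "polyline [a, b] = linepath a b"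
| "polyline (a # b # c # rest) = linepath a b +++ polyline (b # c # rest)"

definition polygon_loop :: "complex list \<Rightarrow> real \<Rightarrow> complex" where
  "polygon_loop vs = polyline (vs @ [hd vs])"

definition simple_polygon :: "complex list \<Rightarrow> bool" where
  "simple_polygon vs \<longleftrightarrow> length vs \<ge> 3 \<and> simple_path (polygon_loop vs) \<and>
     (\<forall>i<length vs. \<not> collinear {vs ! i, vs ! ((i + 1) mod length vs),
                                    vs ! ((i + 2) mod length vs)})"

definition polygon_region :: "complex list \<Rightarrow> complex set" where
  "polygon_region vs = path_image (polygon_loop vs) \<union> inside (path_image (polygon_loop vs))"

text \<open>A vertex is reflex iff its interior angle exceeds \<pi>, i.e. the region is
  not locally convex at it.\<close>
definition reflex_vertex :: "complex list \<Rightarrow> complex \<Rightarrow> bool" where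
  "reflex_vertex vs v \<longleftrightarrow> v \<in> set vs \<and>
     \<not> (\<exists>e>0. convex (polygon_region vs \<inter> cball v e))"

definition paths_in :: "complex set \<Rightarrow> complex \<Rightarrow> complex \<Rightarrow> (real \<Rightarrow> complex) set" where
  "paths_in P a b = {\<gamma>. path \<gamma> \<and> rectifiable \<gamma> \<and> path_image \<gamma> \<subseteq> P \<and>
                        pathstart \<gamma> = a \<and> pathfinish \<gamma> = b}"

definition gdist :: "complex set \<Rightarrow> complex \<Rightarrow> complex \<Rightarrow> real" where
  "gdist P a b = Inf (path_length ` paths_in P a b)"

definition gpath :: "complex set \<Rightarrow> complex \<Rightarrow> complex \<Rightarrow> complex set" where
  "gpath P a b = \<Union>{path_image \<gamma> | \<gamma>. \<gamma> \<in> paths_in P a b \<and> path_length \<gamma> = gdist P a b}"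

definition general_position :: "complex list \<Rightarrow> complex set \<Rightarrow> bool" where
  "general_position vs S \<longleftrightarrow>
     (let P = polygon_region vs in
       (\<forall>x\<in>S. \<forall>y\<in>S. \<forall>z\<in>S. x \<noteq> y \<and> y \<noteq> z \<and> x \<noteq> z \<longrightarrow> y \<notin> gpath P x z) \<and>
       (\<forall>c\<in>P. \<forall>\<rho>. \<forall>Q \<subseteq> S \<union> set vs. card Q = 4 \<longrightarrow> \<not> (\<forall>q\<in>Q. gdist P c q = \<rho>)) \<and>
       (\<forall>x\<in>S. \<forall>y\<in>S. \<forall>p. x \<noteq> y \<and> reflex_vertex vs p \<longrightarrow> y \<notin> gpath P x p) \<and>
       (\<forall>x\<in>S. \<forall>y\<in>S. \<forall>v\<in>set vs. x \<noteq> y \<longrightarrow> gdist P x v \<noteq> gdist P y v))"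

end

theory Submission
  imports Defs "HOL-Complex_Analysis.Complex_Analysis"
begin

text \<open>
  Say that \<open>r, b\<close> force \<open>r', b'\<close> if every geodesic disk through \<open>r\<close> and \<open>b\<close> contains \<open>r'\<close> or
  \<open>b'\<close>. The heart of the matter is that among any three red and three blue points some red-blue
  pair forces a disjoint one. Summing over all such six-tuples then yields a pair \<open>r, b\<close> that forces
  at least \<open>(n/2 - 1)\<^sup>2 / 36\<close> pairs, and the points in a disk through \<open>r\<close> and \<open>b\<close> form a vertex cover
  of these pairs.

  Suppose that no pair forces a disjoint one. A disk with centre \<open>c\<close> through \<open>a\<close> and \<open>b\<close> that misses
  \<open>a'\<close> and \<open>b'\<close> yields a path from \<open>a\<close> via \<open>c\<close> to \<open>b\<close>, made of two nearly shortest paths, all of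
  whose points are nearer to \<open>{a, b}\<close> than to \<open>{a', b'}\<close>; so it is disjoint from the path obtained in
  the same way for \<open>a', b'\<close>. These paths depend on both pairs, but the winding number around \<open>p\<close> of
  a path from \<open>a\<close> to \<open>b\<close> whose points are nearer to \<open>{a, b}\<close> than to \<open>p\<close> is unique: some ray from
  \<open>p\<close> consists, until it leaves the polygon, of points that are at least as near to \<open>p\<close> as to \<open>a\<close>
  and \<open>b\<close>, hence it avoids all these paths. For disjoint paths the winding numbers around each
  other's endpoints satisfy one linear relation, and for the nine edges of \<open>K\<^sub>3\<^sub>,\<^sub>3\<close> these relations
  contradict each other modulo 2.
\<close>

subsection \<open>Path length and geodesic distance\<close>

text \<open>A recursive form of the sums in \<open>partition_sums\<close>, so that cutting and
  refining partitions become list inductions; lists with fewer than two entries get 0.\<close>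

fun chain_length :: "(real \<Rightarrow> complex) \<Rightarrow> real list \<Rightarrow> real" where
  "chain_length \<gamma> (s # t # ts) = dist (\<gamma> t) (\<gamma> s) + chain_length \<gamma> (t # ts)"
| "chain_length \<gamma> _ = 0"

lemma chain_length_eq_sum:
  "chain_length \<gamma> ts = (\<Sum>i<length ts - 1. dist (\<gamma> (ts ! Suc i)) (\<gamma> (ts ! i)))"
  by (induction \<gamma> ts rule: chain_length.induct) (simp_all add: sum.lessThan_Suc_shift del: sum.lessThan_Suc)

lemma partition_sums_eq:
  "partition_sums \<gamma> = {chain_length \<gamma> ts | ts. ts \<noteq> [] \<and> sorted ts \<and> hd ts = 0 \<and> last ts = 1}"
  by (simp add: partition_sums_def chain_length_eq_sum)

lemma chain_length_nonneg: "0 \<le> chain_length \<gamma> ts"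
  by (induction \<gamma> ts rule: chain_length.induct) auto

lemma chain_length_append:
  "chain_length \<gamma> (xs @ t # ys) = chain_length \<gamma> (xs @ [t]) + chain_length \<gamma> (t # ys)"
proof (induction xs)
  case (Cons x xs)
  then show ?case by (cases xs) auto
qed simp

text \<open>The triangle inequality: refining a partition never shortens the chain.
  \<open>join_length\<close> uses it to insert the time 1/2.\<close>

lemma chain_length_insert: "chain_length \<gamma> (xs @ ys) \<le> chain_length \<gamma> (xs @ t # ys)"
proof (induction xs)
  case Nil
  then show ?case by (cases ys) (auto simp: chain_length_nonneg)
next
  case (Cons x xs)
  show ?case
  proof (cases xs)
    case Nil
    show ?thesis
    proof (cases ys)
      case (Cons y ys')
      have "dist (\<gamma> y) (\<gamma> x) \<le> dist (\<gamma> t) (\<gamma> x) + dist (\<gamma> y) (\<gamma> t)"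
        using dist_triangle[of "\<gamma> y" "\<gamma> x" "\<gamma> t"] by simp
      then show ?thesis using Nil Cons by simp
    qed (use Nil in simp)
  qed (use Cons in auto)
qed

lemma chain_length_comp: "chain_length (\<gamma> \<circ> \<phi>) ts = chain_length \<gamma> (map \<phi> ts)"
  by (induction "\<gamma> \<circ> \<phi>" ts rule: chain_length.induct) auto

lemma chain_length_cong:
  "(\<And>t. t \<in> set ts \<Longrightarrow> \<gamma> t = \<delta> t) \<Longrightarrow> chain_length \<gamma> ts = chain_length \<delta> ts"
  by (induction \<gamma> ts rule: chain_length.induct) auto

lemma partition_sums_memI:
  "ts \<noteq> [] \<Longrightarrow> sorted ts \<Longrightarrow> hd ts = 0 \<Longrightarrow> last ts = 1 \<Longrightarrow> chain_length \<gamma> ts \<in> partition_sums \<gamma>"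
  unfolding partition_sums_eq by blast

lemma partition_sums_ne: "partition_sums \<gamma> \<noteq> {}"
  using partition_sums_memI[of "[0,1]" \<gamma>] by auto

lemma chain_length_le_path_length:
  assumes "rectifiable \<gamma>" "ts \<noteq> []" "sorted ts" "hd ts = 0" "last ts = 1"
  shows "chain_length \<gamma> ts \<le> path_length \<gamma>"
  unfolding path_length_def
  by (rule cSup_upper) (use assms in \<open>auto simp: rectifiable_def intro: partition_sums_memI\<close>)

lemma rectifiable_path_length_leI:
  assumes "\<And>ts. ts \<noteq> [] \<Longrightarrow> sorted ts \<Longrightarrow> hd ts = 0 \<Longrightarrow> last ts = 1 \<Longrightarrow> chain_length \<gamma> ts \<le> L"
  shows "rectifiable \<gamma>" "path_length \<gamma> \<le> L"
proof -
  have *: "\<forall>x\<in>partition_sums \<gamma>. x \<le> L"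
    using assms by (auto simp: partition_sums_eq)
  then show "rectifiable \<gamma>" by (auto simp: rectifiable_def bdd_above_def)
  show "path_length \<gamma> \<le> L" unfolding path_length_def
    by (rule cSup_least) (use * partition_sums_ne in auto)
qed

lemma sorted_bounds:
  assumes "sorted ts" "ts \<noteq> []" "t \<in> set ts"
  shows "hd ts \<le> t" "t \<le> (last ts :: real)"
proof -
  show "hd ts \<le> t" using assms by (cases ts) auto
  show "t \<le> last ts" using assms
    by (cases ts rule: rev_cases) (auto simp: sorted_append)
qed

lemma linepath_length:
  "rectifiable (linepath a b)" "path_length (linepath a b) \<le> dist a b"
proof -
  have d: "dist (linepath a b t) (linepath a b s) = \<bar>t - s\<bar> * dist a b" for s t
  proof -
    have "linepath a b t - linepath a b s = (t - s) *\<^sub>R (b - a)"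
      by (simp add: linepath_def algebra_simps)
    then show ?thesis by (simp add: dist_norm norm_minus_commute)
  qed
  have "sorted ts \<Longrightarrow> ts \<noteq> [] \<Longrightarrow> chain_length (linepath a b) ts = (last ts - hd ts) * dist a b" for ts
  proof (induction ts)
    case (Cons s ts)
    then show ?case by (cases ts) (auto simp: d algebra_simps)
  qed simp
  then have *: "ts \<noteq> [] \<Longrightarrow> sorted ts \<Longrightarrow> hd ts = 0 \<Longrightarrow> last ts = 1 \<Longrightarrow>
      chain_length (linepath a b) ts \<le> dist a b" for ts
    by simp
  show "rectifiable (linepath a b)" "path_length (linepath a b) \<le> dist a b"
    by (rule rectifiable_path_length_leI; rule *; assumption)+
qed

lemma path_length_ge_via:
  assumes "rectifiable \<gamma>" "z \<in> path_image \<gamma>"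
  shows "dist (pathstart \<gamma>) z \<le> path_length \<gamma>"
proof -
  obtain t where t: "t \<in> {0..1}" "z = \<gamma> t" using assms by (auto simp: path_image_def)
  have "chain_length \<gamma> [0,t,1] \<le> path_length \<gamma>"
    by (rule chain_length_le_path_length) (use t assms in auto)
  then have "dist z (pathstart \<gamma>) + dist (\<gamma> 1) z \<le> path_length \<gamma>"
    using t by (simp add: pathstart_def)
  then show ?thesis using zero_le_dist[of "\<gamma> 1" z] dist_commute[of z "pathstart \<gamma>"] by linarith
qed

lemma path_length_nonneg: "rectifiable \<gamma> \<Longrightarrow> 0 \<le> path_length \<gamma>"
  by (rule order_trans[OF chain_length_nonneg chain_length_le_path_length[of \<gamma> "[0,1]"]]) auto

text \<open>After 1/2 is inserted, a partition for the joined path splits there into rescaled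
  partitions for \<gamma> and \<delta>.\<close>

lemma join_length:
  assumes r: "rectifiable \<gamma>" "rectifiable \<delta>" and e: "pathfinish \<gamma> = pathstart \<delta>"
  shows "rectifiable (\<gamma> +++ \<delta>)" "path_length (\<gamma> +++ \<delta>) \<le> path_length \<gamma> + path_length \<delta>"
proof -
  have *: "chain_length (\<gamma> +++ \<delta>) ts \<le> path_length \<gamma> + path_length \<delta>"
    if ts: "ts \<noteq> []" "sorted ts" "hd ts = 0" "last ts = 1" for ts
  proof -
    define xs where "xs = takeWhile (\<lambda>t. t \<le> 1/2) ts"
    define ys where "ys = dropWhile (\<lambda>t. t \<le> 1/2) ts"
    have split: "ts = xs @ ys" by (simp add: xs_def ys_def)
    have xs_le: "\<forall>t\<in>set xs. t \<le> 1/2" by (auto simp: xs_def dest: set_takeWhileD)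
    have xs_ne: "xs \<noteq> []" using ts by (cases ts) (auto simp: xs_def)
    have ys_ne: "ys \<noteq> []"
    proof
      assume "ys = []"
      then have "1 \<in> set xs" using split ts last_in_set[of ts] by simp
      then show False using xs_le by force
    qed
    have sx: "sorted xs" and sy: "sorted ys" using ts split by (auto simp: sorted_append)
    have hy: "hd ys > 1/2"
      using ys_ne hd_dropWhile[of "\<lambda>t. t \<le> 1/2" ts] by (auto simp: ys_def)
    have ys_gt: "\<forall>t\<in>set ys. t > 1/2"
      using sorted_bounds(1)[OF sy ys_ne] hy by force
    have "chain_length (\<gamma> +++ \<delta>) ts \<le> chain_length (\<gamma> +++ \<delta>) (xs @ 1/2 # ys)"
      unfolding split by (rule chain_length_insert)
    also have "\<dots> = chain_length (\<gamma> +++ \<delta>) (xs @ [1/2]) + chain_length (\<gamma> +++ \<delta>) (1/2 # ys)"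
      by (rule chain_length_append)
    finally have 0: "chain_length (\<gamma> +++ \<delta>) ts \<le>
      chain_length (\<gamma> +++ \<delta>) (xs @ [1/2]) + chain_length (\<gamma> +++ \<delta>) (1/2 # ys)" .
    have "chain_length (\<gamma> +++ \<delta>) (xs @ [1/2]) = chain_length (\<gamma> \<circ> (\<lambda>t. 2 * t)) (xs @ [1/2])"
      by (rule chain_length_cong) (use xs_le in \<open>auto simp: joinpaths_def\<close>)
    also have "\<dots> = chain_length \<gamma> (map (\<lambda>t. 2 * t) (xs @ [1/2]))"
      by (rule chain_length_comp)
    also have "\<dots> \<le> path_length \<gamma>"
    proof (rule chain_length_le_path_length[OF r(1)])
      have "sorted (map (\<lambda>t. 2 * t) xs)" unfolding sorted_map
        by (rule sorted_wrt_mono_rel[OF _ sx]) simp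
      then show "sorted (map (\<lambda>t. 2 * t) (xs @ [1/2]))" using xs_le by (auto simp: sorted_append)
      show "hd (map (\<lambda>t. 2 * t) (xs @ [1/2])) = 0" using xs_ne ts split by (simp add: hd_map)
    qed auto
    finally have 1: "chain_length (\<gamma> +++ \<delta>) (xs @ [1/2]) \<le> path_length \<gamma>" .
    have "chain_length (\<gamma> +++ \<delta>) (1/2 # ys) = chain_length (\<delta> \<circ> (\<lambda>t. 2 * t - 1)) (1/2 # ys)"
    proof (rule chain_length_cong)
      fix t assume "t \<in> set (1/2 # ys)"
      then consider "t = 1/2" | "t > 1/2" using ys_gt by auto
      then show "(\<gamma> +++ \<delta>) t = (\<delta> \<circ> (\<lambda>t. 2 * t - 1)) t"
      proof cases
        \<comment> \<open>At 1/2 the definition of \<open>+++\<close> still takes the first path, so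
          agreement with \<delta> rests on \<open>e\<close>.\<close>
        case 1
        show ?thesis unfolding 1 using e by (simp add: joinpaths_def pathstart_def pathfinish_def)
      qed (simp add: joinpaths_def)
    qed
    also have "\<dots> = chain_length \<delta> (map (\<lambda>t. 2 * t - 1) (1/2 # ys))"
      by (rule chain_length_comp)
    also have "\<dots> \<le> path_length \<delta>"
    proof (rule chain_length_le_path_length[OF r(2)])
      have "sorted (map (\<lambda>t. 2 * t - 1) ys)" unfolding sorted_map
        by (rule sorted_wrt_mono_rel[OF _ sy]) simp
      then show "sorted (map (\<lambda>t. 2 * t - 1) (1/2 # ys))" using ys_gt by auto
      show "last (map (\<lambda>t. 2 * t - 1) (1/2 # ys)) = 1" using ys_ne ts split by (simp add: last_map)
    qed auto
    finally show ?thesis using 0 1 by simp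
  qed
  show "rectifiable (\<gamma> +++ \<delta>)" "path_length (\<gamma> +++ \<delta>) \<le> path_length \<gamma> + path_length \<delta>"
    by (rule rectifiable_path_length_leI; rule *; assumption)+
qed

text \<open>Partitions of the two pieces, rescaled and glued at the common time \<open>t\<close>,
  form a partition for \<gamma>, so the sum of their chain lengths is at most the length of
  \<gamma>.\<close>

lemma subpath_length:
  assumes r: "rectifiable \<gamma>" and t: "t \<in> {0..1}"
  shows "rectifiable (subpath 0 t \<gamma>)" "rectifiable (subpath t 1 \<gamma>)"
    "path_length (subpath 0 t \<gamma>) + path_length (subpath t 1 \<gamma>) \<le> path_length \<gamma>"
proof -
  let ?f = "\<lambda>s. t * s" and ?g = "\<lambda>s. (1 - t) * s + t"
  have sf: "subpath 0 t \<gamma> = \<gamma> \<circ> ?f" and sg: "subpath t 1 \<gamma> = \<gamma> \<circ> ?g"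
    by (auto simp: subpath_def)
  have *: "chain_length (subpath 0 t \<gamma>) ts + chain_length (subpath t 1 \<gamma>) us \<le> path_length \<gamma>"
    if ts: "ts \<noteq> []" "sorted ts" "hd ts = 0" "last ts = 1"
      and us: "us \<noteq> []" "sorted us" "hd us = 0" "last us = 1" for ts us
  proof -
    obtain ts' where ts': "ts = ts' @ [1]" using ts by (metis append_butlast_last_id)
    obtain us' where us': "us = 0 # us'" using us by (metis list.collapse)
    have "chain_length (subpath 0 t \<gamma>) ts + chain_length (subpath t 1 \<gamma>) us
        = chain_length \<gamma> (map ?f ts' @ [t]) + chain_length \<gamma> (t # map ?g us')"
      unfolding sf sg chain_length_comp ts' us' by simp
    also have "\<dots> = chain_length \<gamma> (map ?f ts' @ t # map ?g us')"
      by (rule chain_length_append[symmetric])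
    also have "\<dots> \<le> path_length \<gamma>"
    proof (rule chain_length_le_path_length[OF r])
      have sts: "sorted ts'" "\<forall>x\<in>set ts'. x \<le> 1" using ts ts' by (auto simp: sorted_append)
      have sus: "sorted us'" "\<forall>x\<in>set us'. 0 \<le> x" using us us' by auto
      have a: "sorted (map ?f ts')" unfolding sorted_map
        by (rule sorted_wrt_mono_rel[OF _ sts(1)]) (use t in \<open>auto simp: mult_left_mono\<close>)
      have b: "sorted (map ?g us')" unfolding sorted_map
        by (rule sorted_wrt_mono_rel[OF _ sus(1)]) (use t in \<open>auto simp: mult_left_mono\<close>)
      have c: "\<forall>x\<in>set ts'. t * x \<le> t" using sts(2) t by (auto simp: mult_left_le)
      have d: "\<forall>x\<in>set us'. t \<le> (1 - t) * x + t" using sus(2) t by auto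
      show "sorted (map ?f ts' @ t # map ?g us')"
        using a b c d by (fastforce simp: sorted_append)
      show "hd (map ?f ts' @ t # map ?g us') = 0"
        using ts ts' by (cases ts') auto
      show "last (map ?f ts' @ t # map ?g us') = 1"
        using us us' by (cases us' rule: rev_cases) auto
    qed simp
    finally show ?thesis .
  qed
  \<comment> \<open>The two suprema are taken one after the other: first over \<open>ts\<close> with
    \<open>us\<close> fixed, then over \<open>us\<close>.\<close>
  have 1: "rectifiable (subpath 0 t \<gamma>)"
    "path_length (subpath 0 t \<gamma>) \<le> path_length \<gamma> - chain_length (subpath t 1 \<gamma>) us"
    if us: "us \<noteq> []" "sorted us" "hd us = 0" "last us = 1" for us
  proof -
    have "chain_length (subpath 0 t \<gamma>) ts \<le> path_length \<gamma> - chain_length (subpath t 1 \<gamma>) us"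
      if "ts \<noteq> []" "sorted ts" "hd ts = 0" "last ts = 1" for ts
      using *[OF that us] by linarith
    note 2 = rectifiable_path_length_leI[where \<gamma> = "subpath 0 t \<gamma>", OF this]
    show "rectifiable (subpath 0 t \<gamma>)"
      "path_length (subpath 0 t \<gamma>) \<le> path_length \<gamma> - chain_length (subpath t 1 \<gamma>) us"
      by (rule 2; assumption)+
  qed
  show "rectifiable (subpath 0 t \<gamma>)" by (rule 1(1)[of "[0,1]"]) auto
  have "chain_length (subpath t 1 \<gamma>) us \<le> path_length \<gamma> - path_length (subpath 0 t \<gamma>)"
    if us: "us \<noteq> []" "sorted us" "hd us = 0" "last us = 1" for us
    using 1(2)[OF us] by linarith
  note 2 = rectifiable_path_length_leI[where \<gamma> = "subpath t 1 \<gamma>", OF this]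
  show "rectifiable (subpath t 1 \<gamma>)" by (rule 2(1); assumption)
  have "path_length (subpath t 1 \<gamma>) \<le> path_length \<gamma> - path_length (subpath 0 t \<gamma>)"
    by (rule 2(2); assumption)
  then show "path_length (subpath 0 t \<gamma>) + path_length (subpath t 1 \<gamma>) \<le> path_length \<gamma>"
    by linarith
qed

section \<open>Geodesic distance as an infimum of path lengths\<close>

lemma gdist_le: "\<gamma> \<in> paths_in P a b \<Longrightarrow> gdist P a b \<le> path_length \<gamma>"
  unfolding gdist_def
  by (rule cInf_lower) (auto intro!: bdd_belowI2[of _ 0] path_length_nonneg simp: paths_in_def)

lemma gdist_ge:
  assumes "paths_in P a b \<noteq> {}" "\<And>\<gamma>. \<gamma> \<in> paths_in P a b \<Longrightarrow> L \<le> path_length \<gamma>"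
  shows "L \<le> gdist P a b"
  unfolding gdist_def by (rule cInf_greatest) (use assms in auto)

text \<open>Stands in for shortest paths: whether the infimum is attained is left open, and strict
  inequalities need only a path that is short enough.\<close>

lemma near_geodesic:
  assumes "paths_in P a b \<noteq> {}" "gdist P a b < L"
  obtains \<gamma> where "\<gamma> \<in> paths_in P a b" "path_length \<gamma> < L"
  using assms gdist_ge[of P a b L] by force

lemma linepath_in_paths_in: "closed_segment a b \<subseteq> P \<Longrightarrow> linepath a b \<in> paths_in P a b"
  by (auto simp: paths_in_def linepath_length)

lemma join_in_paths_in:
  "\<gamma> \<in> paths_in P a b \<Longrightarrow> \<delta> \<in> paths_in P b c \<Longrightarrow> \<gamma> +++ \<delta> \<in> paths_in P a c"
  by (auto simp: paths_in_def join_length path_image_join)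

lemma gdist_le_dist: "closed_segment a b \<subseteq> P \<Longrightarrow> gdist P a b \<le> dist a b"
  using gdist_le[OF linepath_in_paths_in] linepath_length(2) by (meson order_trans)

lemma gdist_triangle:
  assumes "paths_in P a b \<noteq> {}" "paths_in P b c \<noteq> {}"
  shows "gdist P a c \<le> gdist P a b + gdist P b c"
proof -
  have *: "gdist P a c \<le> path_length \<gamma> + path_length \<delta>"
    if "\<gamma> \<in> paths_in P a b" "\<delta> \<in> paths_in P b c" for \<gamma> \<delta>
    using gdist_le[OF join_in_paths_in[OF that]] that join_length(2)[of \<gamma> \<delta>]
    by (auto simp: paths_in_def)
  have "gdist P a c - path_length \<gamma> \<le> gdist P b c" if "\<gamma> \<in> paths_in P a b" for \<gamma>
    by (rule gdist_ge[OF assms(2)]) (use *[OF that] in fastforce)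
  then have "gdist P a c - gdist P b c \<le> gdist P a b"
    by (intro gdist_ge[OF assms(1)]) fastforce
  then show ?thesis by simp
qed

text \<open>Cutting \<gamma> at \<open>x\<close> gives competitors for both distances. For a nearly
  shortest path this replaces additivity of distance along a geodesic.\<close>

lemma gdist_split_le_path_length:
  assumes "\<gamma> \<in> paths_in P a b" "x \<in> path_image \<gamma>"
  shows "gdist P a x + gdist P x b \<le> path_length \<gamma>"
proof -
  obtain t where t: "t \<in> {0..1}" "x = \<gamma> t" using assms by (auto simp: path_image_def)
  have g: "path \<gamma>" "rectifiable \<gamma>" "path_image \<gamma> \<subseteq> P" "pathstart \<gamma> = a" "pathfinish \<gamma> = b"
    using assms(1) by (auto simp: paths_in_def)
  have "path_image (subpath 0 t \<gamma>) \<subseteq> P" "path_image (subpath t 1 \<gamma>) \<subseteq> P"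
    using path_image_subpath_subset[of 0 t \<gamma>] path_image_subpath_subset[of t 1 \<gamma>] t g by auto
  then have "subpath 0 t \<gamma> \<in> paths_in P a x" "subpath t 1 \<gamma> \<in> paths_in P x b"
    using g t subpath_length[OF g(2) t(1)] by (auto simp: paths_in_def) (auto simp: pathstart_def pathfinish_def)
  from this[THEN gdist_le] show ?thesis using subpath_length(3)[OF g(2) t(1)] by linarith
qed

lemma paths_in_mono: "P \<subseteq> Q \<Longrightarrow> paths_in P a b \<subseteq> paths_in Q a b"
  by (auto simp: paths_in_def)

subsection \<open>Polygonal regions\<close>

lemma polyline_path:
  "path (polyline vs)" "vs \<noteq> [] \<Longrightarrow> pathstart (polyline vs) = hd vs"
  by (induction vs rule: polyline.induct) auto

text \<open>Any two points of the boundary loop can then be connected via its first vertex. Both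
  directions are carried through the induction, which avoids reversing rectifiable paths.\<close>

lemma polyline_paths_in:
  assumes "vs \<noteq> []" "x \<in> path_image (polyline vs)"
  shows "paths_in (path_image (polyline vs)) (hd vs) x \<noteq> {} \<and>
         paths_in (path_image (polyline vs)) x (hd vs) \<noteq> {}"
  using assms
proof (induction vs rule: polyline.induct)
  case 1
  then show ?case by simp
next
  case (2 a)
  then show ?case using linepath_in_paths_in[of a a "{a}"] by auto
next
  case (3 a b)
  then have "closed_segment a x \<subseteq> closed_segment a b" "closed_segment x a \<subseteq> closed_segment a b"
    by (simp_all add: subset_closed_segment)
  from this[THEN linepath_in_paths_in] show ?case by auto
next
  case (4 a b c rest)
  let ?Q = "path_image (polyline (b # c # rest))"
  have img: "path_image (polyline (a # b # c # rest)) = closed_segment a b \<union> ?Q"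
    using polyline_path(2)[of "b # c # rest"] by (simp add: path_image_join)
  show ?case
  proof (cases "x \<in> closed_segment a b")
    case True
    then have "closed_segment a x \<subseteq> closed_segment a b \<union> ?Q"
      "closed_segment x a \<subseteq> closed_segment a b \<union> ?Q"
      by (auto simp: subset_closed_segment dest: subset_closed_segment[THEN iffD2, THEN subsetD, rotated])
    from this[THEN linepath_in_paths_in] show ?thesis unfolding img by auto
  next
    case False
    then have "x \<in> ?Q" using 4 img by auto
    with 4 have "paths_in ?Q b x \<noteq> {}" "paths_in ?Q x b \<noteq> {}" by auto
    then obtain \<gamma> \<delta> where g: "\<gamma> \<in> paths_in ?Q b x" "\<delta> \<in> paths_in ?Q x b" by blast
    have mono: "paths_in ?Q u v \<subseteq> paths_in (closed_segment a b \<union> ?Q) u v" for u v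
      by (rule paths_in_mono) auto
    have "linepath a b \<in> paths_in (closed_segment a b \<union> ?Q) a b"
      "linepath b a \<in> paths_in (closed_segment a b \<union> ?Q) b a"
      by (auto intro!: linepath_in_paths_in simp: closed_segment_commute)
    then have "linepath a b +++ \<gamma> \<in> paths_in (closed_segment a b \<union> ?Q) a x"
      "\<delta> +++ linepath b a \<in> paths_in (closed_segment a b \<union> ?Q) x a"
      using g mono by (auto intro!: join_in_paths_in)
    then show ?thesis unfolding img by auto
  qed
qed

text \<open>The properties of a polygon on which the topological argument rests.
  \<open>no_holes\<close> puts every point of the complement into an unbounded component, where
  loops inside \<open>P\<close> have winding number 0.\<close>

locale geodesic_region =
  fixes P :: "complex set"
  assumes closed: "closed P" and bounded: "bounded P"
    and no_holes: "- P \<subseteq> outside P"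
    and paths_ne: "\<lbrakk>a \<in> P; b \<in> P\<rbrakk> \<Longrightarrow> paths_in P a b \<noteq> {}"

lemma geodesic_region_polygon:
  assumes "vs \<noteq> []"
  shows "geodesic_region (polygon_region vs)"
proof
  define I where "I = path_image (polygon_loop vs)"
  define P where "P = polygon_region vs"
  have P: "P = I \<union> inside I" by (simp add: P_def polygon_region_def I_def)
  have cI: "compact I" unfolding I_def polygon_loop_def
    by (intro compact_path_image polyline_path)
  then have clI: "closed I" and bI: "bounded I" by (simp_all add: compact_imp_closed compact_imp_bounded)
  \<comment> \<open>Adding its inside to the loop leaves exactly the outside as complement, which is
    connected and unbounded.\<close>
  have P': "- P = outside I" unfolding P using inside_Un_outside[of I] union_with_inside[of I] by blast
  show "closed (polygon_region vs)"
    using open_outside[OF clI] by (simp flip: P_def P' add: closed_def)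
  show "bounded (polygon_region vs)"
    using bI bounded_inside[OF bI] by (simp flip: P_def add: P)
  show "- polygon_region vs \<subseteq> outside (polygon_region vs)"
  proof -
    have "connected (- P)" unfolding P' by (rule connected_outside[OF bI]) simp
    moreover have "\<not> bounded (- P)"
      unfolding P' by (rule unbounded_outside[OF bI])
    ultimately have "- P \<subseteq> outside P"
      by (auto simp: outside_def connected_component_eq_self)
    then show ?thesis by (simp flip: P_def)
  qed
  \<comment> \<open>From a point inside the loop, the horizontal ray is followed until it first
    meets the frontier, which lies on the loop.\<close>
  have toI: "\<exists>y\<in>I. closed_segment x y \<subseteq> P" if "x \<in> P" for x
  proof (cases "x \<in> I")
    case True
    then show ?thesis using that by (intro bexI[of _ x]) auto
  next
    case False
    then have xin: "x \<in> inside I" using that P by auto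
    obtain d where d: "0 < d" "x + d *\<^sub>R 1 \<in> frontier (inside I)"
      "\<And>e. \<lbrakk>0 \<le> e; e < d\<rbrakk> \<Longrightarrow> x + e *\<^sub>R 1 \<in> interior (inside I)"
      using ray_to_frontier[OF bounded_inside[OF bI], of x "1::complex"] xin open_inside[OF clI]
      by (auto simp: interior_open)
    let ?y = "x + d *\<^sub>R (1::complex)"
    have y: "?y \<in> I" using d frontier_inside_subset[OF clI] by blast
    have "closed_segment x ?y \<subseteq> P"
    proof
      fix z assume "z \<in> closed_segment x ?y"
      then obtain s where s: "0 \<le> s" "s \<le> 1" "z = (1 - s) *\<^sub>R x + s *\<^sub>R ?y" 
        by (auto simp: in_segment)
      then have z: "z = x + (s * d) *\<^sub>R 1" by (simp add: algebra_simps scaleR_conv_of_real)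
      show "z \<in> P"
      proof (cases "s = 1")
        case True
        then show ?thesis using y z P by auto
      next
        case False
        then have "s * d < d" using s d by auto
        then have "z \<in> interior (inside I)" unfolding z using d(1) s by (intro d(3)) auto
        then show ?thesis using P interior_subset by auto
      qed
    qed
    with y show ?thesis by blast
  qed
  have IP: "I \<subseteq> P" by (simp add: P)
  show "paths_in (polygon_region vs) a b \<noteq> {}"
    if mem: "a \<in> polygon_region vs" "b \<in> polygon_region vs" for a b
  proof -
    obtain a' b' where ab: "a' \<in> I" "closed_segment a a' \<subseteq> P" "b' \<in> I" "closed_segment b' b \<subseteq> P"
      using toI[of a] toI[of b] mem by (auto simp: P_def closed_segment_commute)
    have ne: "vs @ [hd vs] \<noteq> []" by simp
    obtain \<gamma> \<delta> where "\<gamma> \<in> paths_in I a' (hd vs)" "\<delta> \<in> paths_in I (hd vs) b'"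
      using polyline_paths_in[OF ne, of a'] polyline_paths_in[OF ne, of b'] ab(1,3) assms
      unfolding I_def polygon_loop_def by auto
    then have "\<gamma> \<in> paths_in P a' (hd vs)" "\<delta> \<in> paths_in P (hd vs) b'"
      using paths_in_mono[OF IP] by auto
    then have "linepath a a' +++ \<gamma> +++ \<delta> +++ linepath b' b \<in> paths_in P a b"
      using ab linepath_in_paths_in by (blast intro: join_in_paths_in)
    then show ?thesis by (auto simp flip: P_def)
  qed
qed

subsection \<open>Paths that stay nearer to their endpoints than to a given point\<close>

text \<open>On the compact set the inner product with \<open>u\<close> has a positive minimum.
  Changing \<open>u\<close> by less than this minimum over a norm bound \<open>M\<close> keeps all
  products positive, by Cauchy-Schwarz.\<close>

lemma open_pos_inner_compact:
  fixes K :: "'a::real_inner set"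
  assumes "compact K"
  shows "open {u. \<forall>z\<in>K. 0 < z \<bullet> u}"
proof (cases "K = {}")
  case False
  show ?thesis unfolding open_dist
  proof clarify
    fix u assume u: "\<forall>z\<in>K. 0 < z \<bullet> u"
    have "continuous_on K (\<lambda>z. z \<bullet> u)" by (intro continuous_intros)
    from continuous_attains_inf[OF assms False this]
    obtain z0 where z0: "z0 \<in> K" "\<And>z. z \<in> K \<Longrightarrow> z0 \<bullet> u \<le> z \<bullet> u" by blast
    obtain M where M: "0 < M" "\<And>z. z \<in> K \<Longrightarrow> norm z \<le> M"
      using compact_imp_bounded[OF assms] by (auto simp: bounded_pos)
    show "\<exists>e>0. \<forall>v. dist v u < e \<longrightarrow> v \<in> {u. \<forall>z\<in>K. 0 < z \<bullet> u}"
    proof (intro exI[of _ "(z0 \<bullet> u) / M"] conjI allI impI, goal_cases)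
      case 1
      then show ?case using u z0 M by simp
    next
      case (2 v)
      have "0 < z \<bullet> v" if "z \<in> K" for z
      proof -
        have "\<bar>z \<bullet> (v - u)\<bar> \<le> norm z * norm (v - u)" by (rule Cauchy_Schwarz_ineq2)
        also have "\<dots> \<le> M * norm (v - u)" by (intro mult_right_mono M that) auto
        also have "\<dots> < z0 \<bullet> u" using 2 M(1) by (simp add: dist_norm field_simps)
        also have "\<dots> \<le> z \<bullet> u" by (rule z0(2)[OF that])
        finally show ?thesis by (simp add: inner_diff_right)
      qed
      then show ?case by blast
    qed
  qed
qed simp

context geodesic_region
begin

text \<open>For \<open>ball p e \<subseteq> P\<close>: the point \<open>a\<close> lies in the component at \<open>p\<close> of the part of \<open>P\<close> strictly on
  the \<open>u\<close>-side of the line through \<open>p\<close> orthogonal to \<open>u\<close>. Otherwise every path in \<open>P\<close> from a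
  point of the ray \<open>p + t u\<close> to \<open>a\<close> meets that line, and so has length at least \<open>t\<close>.\<close>
definition sees_side :: "complex \<Rightarrow> real \<Rightarrow> complex \<Rightarrow> complex \<Rightarrow> bool" where
  "sees_side p e a u \<longleftrightarrow> (\<exists>g. path g \<and> path_image g \<subseteq> {z \<in> P. 0 < (z - p) \<bullet> u} \<and>
     pathstart g = a \<and> pathfinish g \<in> ball p e)"

text \<open>For a fixed path the admissible directions form an open set because its image is
  compact; the set in question is the union of these over all paths.\<close>

lemma open_sees_side: "open {u. sees_side p e a u}"
proof -
  define G where "G = {g. path g \<and> path_image g \<subseteq> P \<and> pathstart g = a \<and> pathfinish g \<in> ball p e}"
  have "{u. sees_side p e a u} = (\<Union>g\<in>G. {u. \<forall>z\<in>(\<lambda>z. z - p) ` path_image g. 0 < z \<bullet> u})"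
    by (auto simp: sees_side_def G_def)
  moreover have "open {u. \<forall>z\<in>(\<lambda>z. z - p) ` path_image g. 0 < z \<bullet> u}" if "g \<in> G" for g
    using that by (intro open_pos_inner_compact compact_continuous_image continuous_intros)
      (auto simp: G_def)
  ultimately show ?thesis by auto
qed

text \<open>The point \<open>a\<close> lies on its own witnessing path, hence strictly on one side
  of the line.\<close>

lemma not_sees_side_opposite:
  assumes "sees_side p e a u"
  shows "\<not> sees_side p e a (- u)"
proof -
  have *: "0 < (a - p) \<bullet> v" if v: "sees_side p e a v" for v
  proof -
    obtain g where g: "path_image g \<subseteq> {z \<in> P. 0 < (z - p) \<bullet> v}" "pathstart g = a"
      using v by (auto simp: sees_side_def)
    then have "a \<in> path_image g" using pathstart_in_path_image[of g] by simp
    then show ?thesis using g by auto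
  qed
  show ?thesis using *[OF assms] *[of "- u"] by auto
qed

text \<open>The directions on whose side \<open>a\<close> is seen form an open set disjoint from its antipodal image,
  and so do those for \<open>b\<close>; two such sets cannot cover the connected circle.\<close>
lemma unseen_direction:
  obtains u :: complex where "norm u = 1" "\<not> sees_side p e a u" "\<not> sees_side p e b u"
proof -
  define A B where "A = {u. sees_side p e a u}" and "B = {u. sees_side p e b u}"
  have op: "open A" "open B" by (auto simp: A_def B_def open_sees_side)
  have neg: "u \<in> A \<Longrightarrow> - u \<notin> A" "u \<in> B \<Longrightarrow> - u \<notin> B" for u
    using not_sees_side_opposite by (auto simp: A_def B_def)
  have "\<not> sphere 0 1 \<subseteq> A \<union> B"
  proof
    assume cov: "sphere 0 1 \<subseteq> A \<union> B"
    have neg_sphere: "- u \<in> sphere 0 1" if "u \<in> sphere 0 1" for u :: complex using that by simp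
    \<comment> \<open>A direction in both sets has its antipode in neither, against the assumed
      covering.\<close>
    have "A \<inter> B \<inter> sphere 0 1 = {}"
      using cov neg neg_sphere by blast
    moreover have "connected (sphere 0 (1::real) :: complex set)"
      by (rule connected_sphere) simp
    ultimately have "A \<inter> sphere 0 1 = {} \<or> B \<inter> sphere 0 1 = {}"
      using op cov by (auto dest: connectedD)
    moreover have "(1::complex) \<in> sphere 0 1" "(-1::complex) \<in> sphere 0 1" by auto
    \<comment> \<open>One of the sets contains the whole circle, in particular the antipodes
      \<open>1\<close> and \<open>-1\<close>.\<close>
    ultimately show False using cov neg[of 1] by blast
  qed
  then obtain u where "u \<in> sphere 0 1" "u \<notin> A" "u \<notin> B" by blast
  then show ?thesis using that[of u] by (simp add: A_def B_def)
qed

text \<open>A path from the ray to \<open>a\<close> that stays strictly on the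
  \<open>u\<close>-side, reversed and continued down the ray into the ball, would show that
  \<open>a\<close> is seen. So each path reaches a point whose \<open>u\<close>-coordinate relative
  to \<open>p\<close> is at most 0.\<close>

lemma gdist_ge_unseen:
  assumes "norm u = 1" "\<not> sees_side p e a u" "0 < e" "0 < t" "a \<in> P"
    and seg: "closed_segment p (p + t *\<^sub>R u) \<subseteq> P"
  shows "t \<le> gdist P (p + t *\<^sub>R u) a"
proof (rule gdist_ge)
  define x where "x = p + t *\<^sub>R u"
  have uu: "u \<bullet> u = 1" using assms(1) by (simp add: power2_norm_eq_inner[symmetric])
  have "x \<in> P" using seg by (auto simp: x_def)
  then show "paths_in P (p + t *\<^sub>R u) a \<noteq> {}" using paths_ne assms(5) by (simp add: x_def)
  fix \<gamma> assume "\<gamma> \<in> paths_in P (p + t *\<^sub>R u) a"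
  then have g: "path \<gamma>" "rectifiable \<gamma>" "path_image \<gamma> \<subseteq> P" "pathstart \<gamma> = x" "pathfinish \<gamma> = a"
    by (auto simp: paths_in_def x_def)
  have "\<exists>z\<in>path_image \<gamma>. (z - p) \<bullet> u \<le> 0"
  proof (rule ccontr)
    assume "\<not> ?thesis"
    then have pos: "\<forall>z\<in>path_image \<gamma>. 0 < (z - p) \<bullet> u" by auto
    \<comment> \<open>The continuation must end inside \<open>ball p e\<close> without overshooting
      its start \<open>x\<close>.\<close>
    define s where "s = min t (e / 2)"
    define y where "y = p + s *\<^sub>R u"
    have s: "0 < s" "s \<le> t" "s < e" using assms by (auto simp: s_def)
    have sub: "closed_segment x y \<subseteq> {z \<in> P. 0 < (z - p) \<bullet> u}"
    proof
      fix z assume "z \<in> closed_segment x y"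
      then obtain v where v: "0 \<le> v" "v \<le> 1" "z = (1 - v) *\<^sub>R x + v *\<^sub>R y" by (auto simp: in_segment)
      define w where "w = (1 - v) * t + v * s"
      have z: "z = p + w *\<^sub>R u"
        using v by (simp add: x_def y_def w_def algebra_simps)
      have "w \<ge> (1 - v) * s + v * s" unfolding w_def using v s by (intro add_mono mult_mono) auto
      then have w0: "w > 0" using s by (simp add: algebra_simps)
      have "w \<le> (1 - v) * t + v * t" unfolding w_def using v s by (intro add_mono mult_mono) auto
      then have wt: "w \<le> t" by (simp add: algebra_simps)
      have "z = (1 - w / t) *\<^sub>R p + (w / t) *\<^sub>R (p + t *\<^sub>R u)"
        using assms(4) by (simp add: z algebra_simps)
      then have "z \<in> closed_segment p (p + t *\<^sub>R u)"
        unfolding in_segment using w0 wt assms(4) by (intro exI[of _ "w / t"]) auto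
      then show "z \<in> {z \<in> P. 0 < (z - p) \<bullet> u}" using seg w0 by (auto simp: z uu)
    qed
    have "sees_side p e a u" unfolding sees_side_def
    proof (intro exI[of _ "reversepath \<gamma> +++ linepath x y"] conjI)
      show "path_image (reversepath \<gamma> +++ linepath x y) \<subseteq> {z \<in> P. 0 < (z - p) \<bullet> u}"
        using sub g pos by (subst path_image_join) auto
      show "pathfinish (reversepath \<gamma> +++ linepath x y) \<in> ball p e"
        using s assms(1) by (simp add: y_def dist_norm)
    qed (use g in auto)
    then show False using assms(2) by simp
  qed
  then obtain z where z: "z \<in> path_image \<gamma>" "(z - p) \<bullet> u \<le> 0" by blast
  have "t \<le> (x - z) \<bullet> u" using z uu by (simp add: x_def inner_diff_left inner_add_left)
  also have "\<dots> \<le> norm (x - z) * norm u" by (rule norm_cauchy_schwarz)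
  also have "\<dots> = dist x z" using assms(1) by (simp add: dist_norm)
  also have "\<dots> \<le> path_length \<gamma>" using path_length_ge_via[OF g(2) z(1)] g by simp
  finally show "t \<le> path_length \<gamma>" .
qed

lemma gdist_nonneg: "a \<in> P \<Longrightarrow> b \<in> P \<Longrightarrow> 0 \<le> gdist P a b"
  by (intro gdist_ge paths_ne) (auto simp: paths_in_def path_length_nonneg)

lemma gdist_self: "a \<in> P \<Longrightarrow> gdist P a a = 0"
  using gdist_le_dist[of a a P] gdist_nonneg[of a a] by simp

text \<open>The segment follows an unseen direction until it first leaves the interior of
  \<open>P\<close>. At parameter \<open>t\<close> the distance to \<open>p\<close> is at most
  \<open>t\<close>, while the distances to \<open>a\<close> and \<open>b\<close> are at least
  \<open>t\<close>. If \<open>p\<close> is not interior, the segment degenerates to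
  \<open>p\<close>.\<close>

lemma escape_segment:
  assumes "p \<in> P" "a \<in> P" "b \<in> P"
  obtains q where "q \<in> closure (- P)"
    "\<And>x. x \<in> closed_segment p q \<Longrightarrow> gdist P x p \<le> min (gdist P x a) (gdist P x b)"
proof (cases "p \<in> interior P")
  case False
  then have "p \<in> closure (- P)" by (simp add: closure_complement)
  then show ?thesis
    using that[of p] assms gdist_self gdist_nonneg by auto
next
  case True
  then obtain e where e: "0 < e" "ball p e \<subseteq> P" by (auto simp: mem_interior)
  obtain u :: complex where u: "norm u = 1" "\<not> sees_side p e a u" "\<not> sees_side p e b u"
    by (rule unseen_direction)
  then have "u \<noteq> 0" by auto
  obtain d where d: "0 < d" "p + d *\<^sub>R u \<in> frontier P"
      "\<And>e. \<lbrakk>0 \<le> e; e < d\<rbrakk> \<Longrightarrow> p + e *\<^sub>R u \<in> interior P"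
    using ray_to_frontier[OF bounded True \<open>u \<noteq> 0\<close>] by blast
  have inP: "p + s *\<^sub>R u \<in> P" if "0 \<le> s" "s \<le> d" for s
  proof (cases "s = d")
    case True
    then show ?thesis using d(2) closed frontier_subset_closed by blast
  next
    case False
    then show ?thesis using d(3)[of s] that interior_subset by auto
  qed
  show ?thesis
  proof (rule that)
    show "p + d *\<^sub>R u \<in> closure (- P)" using d(2) by (auto simp: frontier_closures)
    fix x assume "x \<in> closed_segment p (p + d *\<^sub>R u)"
    then obtain v where v: "0 \<le> v" "v \<le> 1" "x = (1 - v) *\<^sub>R p + v *\<^sub>R (p + d *\<^sub>R u)"
      by (auto simp: in_segment)
    define t where "t = v * d"
    have x: "x = p + t *\<^sub>R u" using v by (simp add: t_def algebra_simps)
    have t: "0 \<le> t" "t \<le> d" using v d(1) by (auto simp: t_def mult_left_le_one_le)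
    have seg: "closed_segment p (p + t *\<^sub>R u) \<subseteq> P"
    proof
      fix z assume "z \<in> closed_segment p (p + t *\<^sub>R u)"
      then obtain w where w: "0 \<le> w" "w \<le> 1" "z = (1 - w) *\<^sub>R p + w *\<^sub>R (p + t *\<^sub>R u)"
        by (auto simp: in_segment)
      then have "z = p + (w * t) *\<^sub>R u" by (simp add: algebra_simps)
      moreover have "0 \<le> w * t" "w * t \<le> d" using w t mult_left_le_one_le[of t w] by auto
      ultimately show "z \<in> P" using inP by simp
    qed
    have "gdist P x p \<le> dist x p"
      by (rule gdist_le_dist) (use seg in \<open>simp add: x closed_segment_commute\<close>)
    also have "dist x p = t" using u t by (simp add: x dist_norm)
    finally have le: "gdist P x p \<le> t" .
    show "gdist P x p \<le> min (gdist P x a) (gdist P x b)"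
    proof (cases "t = 0")
      case True
      then show ?thesis using x assms gdist_self gdist_nonneg by auto
    next
      case False
      then show ?thesis
        using le gdist_ge_unseen[OF u(1,2) e(1) _ assms(2) seg]
          gdist_ge_unseen[OF u(1,3) e(1) _ assms(3) seg] t x by auto
    qed
  qed
qed

section \<open>Winding numbers of paths nearer to their endpoints than to a point\<close>

definition nearer_path :: "complex \<Rightarrow> complex \<Rightarrow> complex \<Rightarrow> (real \<Rightarrow> complex) \<Rightarrow> bool" where
  "nearer_path a b p \<gamma> \<longleftrightarrow> path \<gamma> \<and> path_image \<gamma> \<subseteq> P \<and> pathstart \<gamma> = a \<and> pathfinish \<gamma> = b \<and>
     (\<forall>x\<in>path_image \<gamma>. min (gdist P x a) (gdist P x b) < gdist P x p)"

text \<open>At \<open>p\<close> itself the strict inequality would demand a negative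
  distance.\<close>

lemma nearer_path_avoids:
  assumes "nearer_path a b p \<gamma>" "p \<in> P"
  shows "p \<notin> path_image \<gamma>"
proof
  assume "p \<in> path_image \<gamma>"
  moreover have "a \<in> P" "b \<in> P" using assms unfolding nearer_path_def
    by (metis pathstart_in_path_image pathfinish_in_path_image subsetD)+
  ultimately have "min (gdist P p a) (gdist P p b) < gdist P p p" "0 \<le> gdist P p a" "0 \<le> gdist P p b"
    using assms gdist_nonneg by (auto simp: nearer_path_def)
  then show False using gdist_self[OF assms(2)] by auto
qed

text \<open>The winding number is constant along the segment to \<open>q\<close> and then on a small
  ball around \<open>q\<close>. This ball contains a point outside \<open>P\<close>, where it is
  0.\<close>

lemma winding_number_loop_zero:
  assumes L: "path L" "pathfinish L = pathstart L" "path_image L \<subseteq> P"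
    and q: "q \<in> closure (- P)" "closed_segment p q \<inter> path_image L = {}"
  shows "winding_number L p = 0"
proof -
  have "q \<notin> path_image L" using q by auto
  moreover have "open (- path_image L)" using closed_path_image[OF L(1)] by (simp add: open_Compl)
  ultimately obtain e where e: "0 < e" "ball q e \<subseteq> - path_image L"
    by (meson ComplI open_contains_ball)
  then obtain z where z: "z \<in> - P" "z \<in> ball q e"
    using q(1) by (auto simp: closure_approachable dist_commute)
  have "winding_number L p = winding_number L q"
    by (rule winding_number_eq[OF L(1,2), of _ "closed_segment p q"]) (use q in auto)
  also have "\<dots> = winding_number L z"
    by (rule winding_number_eq[OF L(1,2), of _ "ball q e"]) (use e z in auto)
  also have "\<dots> = 0"
    using no_holes z outside_mono[OF L(3)] winding_number_zero_in_outside[OF L(1,2)] by blast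
  finally show ?thesis .
qed

text \<open>The difference is the winding number of the loop \<gamma> followed by \<delta> reversed,
  and this loop misses the segment from \<open>escape_segment\<close>.\<close>

lemma winding_number_nearer_path_unique:
  assumes "nearer_path a b p \<gamma>" "nearer_path a b p \<delta>" "p \<in> P"
  shows "winding_number \<gamma> p = winding_number \<delta> p"
proof -
  have ab: "a \<in> P" "b \<in> P" using assms unfolding nearer_path_def
    by (metis pathstart_in_path_image pathfinish_in_path_image subsetD)+
  obtain q where q: "q \<in> closure (- P)"
    "\<And>x. x \<in> closed_segment p q \<Longrightarrow> gdist P x p \<le> min (gdist P x a) (gdist P x b)"
    using escape_segment[OF assms(3) ab] by blast
  let ?L = "\<gamma> +++ reversepath \<delta>"
  have g: "path \<gamma>" "path \<delta>" "pathstart \<gamma> = a" "pathstart \<delta> = a" "pathfinish \<gamma> = b" "pathfinish \<delta> = b"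
    "path_image \<gamma> \<subseteq> P" "path_image \<delta> \<subseteq> P"
    using assms by (auto simp: nearer_path_def)
  have img: "path_image ?L = path_image \<gamma> \<union> path_image \<delta>"
    using g by (simp add: path_image_join)
  have "closed_segment p q \<inter> path_image ?L = {}"
    unfolding img using q(2) assms(1,2) by (fastforce simp: nearer_path_def not_less[symmetric])
  then have "winding_number ?L p = 0"
    by (intro winding_number_loop_zero[OF _ _ _ q(1)]) (use g img in auto)
  moreover have "winding_number ?L p = winding_number \<gamma> p - winding_number \<delta> p"
    using g nearer_path_avoids[OF assms(1,3)] nearer_path_avoids[OF assms(2,3)]
    by (simp add: winding_number_join winding_number_reversepath)
  ultimately show ?thesis by simp
qed

text \<open>For \<open>x\<close> on a path from \<open>c\<close> to \<open>s\<close> shorter than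
  \<sigma>, the distances from \<open>c\<close> to \<open>x\<close> and from \<open>x\<close> to
  \<open>s\<close> sum to less than \<sigma>, while via \<open>x\<close> it takes at least \<sigma>
  to reach \<open>p\<close>. The path is chosen before \<open>p\<close>, so one path serves both
  points missed by a disk.\<close>

lemma nearer_path_through_centre:
  assumes "c \<in> P" "a \<in> P" "b \<in> P" "gdist P c a = \<rho>" "gdist P c b = \<rho>" "\<rho> < \<sigma>"
  obtains \<gamma> where "\<And>p. p \<in> P \<Longrightarrow> \<sigma> \<le> gdist P c p \<Longrightarrow> nearer_path a b p \<gamma>"
proof -
  have near: "gdist P x s < gdist P x p"
    if g: "g \<in> paths_in P c s" "path_length g < \<sigma>" and x: "x \<in> path_image g"
      and s: "s \<in> P" and p: "p \<in> P" "\<sigma> \<le> gdist P c p" for g s x p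
  proof -
    have xP: "x \<in> P" using g x by (auto simp: paths_in_def)
    have "gdist P c p \<le> gdist P c x + gdist P x p"
      by (intro gdist_triangle paths_ne assms xP p)
    with gdist_split_le_path_length[OF g(1) x] g(2) p(2) show ?thesis by linarith
  qed
  obtain g where g: "g \<in> paths_in P c a" "path_length g < \<sigma>"
    using near_geodesic[OF paths_ne[OF assms(1,2)], of \<sigma>] assms by auto
  obtain h where h: "h \<in> paths_in P c b" "path_length h < \<sigma>"
    using near_geodesic[OF paths_ne[OF assms(1,3)], of \<sigma>] assms by auto
  have "nearer_path a b p (reversepath g +++ h)" if p: "p \<in> P" "\<sigma> \<le> gdist P c p" for p
  proof -
    have *: "path g" "path h" "pathstart g = c" "pathstart h = c" "pathfinish g = a" "pathfinish h = b"
      "path_image g \<subseteq> P" "path_image h \<subseteq> P"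
      using g h by (auto simp: paths_in_def)
    show ?thesis
      using * near[OF g _ assms(2) p] near[OF h _ assms(3) p]
      by (auto simp: nearer_path_def path_image_join min_less_iff_disj)
  qed
  then show ?thesis using that by blast
qed

end

subsection \<open>Non-planarity of the complete bipartite graph on three and three points\<close>

text \<open>Two continuous logarithms of \<gamma> t - z differ at each time by a multiple of 2 pi i.
  Distinct such values are at least 2 pi apart, so the difference is constant and the increments
  agree.\<close>

lemma winding_number_log:
  assumes g: "path \<gamma>" "z \<notin> path_image \<gamma>" and h: "continuous_on {0..1} h"
    and eq: "\<And>t. t \<in> {0..1} \<Longrightarrow> \<gamma> t - z = exp (h t)"
  shows "h 1 - h 0 = 2 * of_real pi * \<i> * winding_number \<gamma> z"
proof -
  obtain q where q: "path q" "pathfinish q - pathstart q = 2 * of_real pi * \<i> * winding_number \<gamma> z"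
    "\<And>t. t \<in> {0..1} \<Longrightarrow> \<gamma> t = z + exp (q t)"
    using winding_number_as_continuous_log[OF g] by blast
  have "(\<lambda>t. q t - h t) constant_on {0..1}"
  proof (rule continuous_discrete_range_constant)
    show "continuous_on {0..1} (\<lambda>t. q t - h t)"
      using q(1) h by (auto simp: path_def intro!: continuous_intros)
    fix x :: real assume x: "x \<in> {0..1}"
    have "2 * pi \<le> norm (q y - h y - (q x - h x))"
      if y: "y \<in> {0..1}" "q y - h y \<noteq> q x - h x" for y
    proof -
      have "exp (q t) = exp (h t)" if "t \<in> {0..1}" for t
        using eq[OF that] q(3)[OF that] by simp
      then have "exp (q y - h y) = exp (q x - h x)" using x y by (simp add: exp_diff)
      then obtain n :: int where n: "q y - h y = q x - h x + of_int (2 * n) * of_real pi * \<i>"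
        by (auto simp: exp_eq)
      then have "n \<noteq> 0" using y by auto
      have "norm (q y - h y - (q x - h x)) = \<bar>of_int (2 * n)\<bar> * pi"
        unfolding n by (simp add: norm_mult)
      also have "\<dots> \<ge> 2 * pi" using \<open>n \<noteq> 0\<close> by (intro mult_right_mono) auto
      finally show ?thesis .
    qed
    then show "\<exists>e>0. \<forall>y. y \<in> {0..1} \<and> q y - h y \<noteq> q x - h x \<longrightarrow> e \<le> norm (q y - h y - (q x - h x))"
      by (intro exI[of _ "2 * pi"]) auto
  qed simp
  then have "q 1 - h 1 = q 0 - h 0" by (auto simp: constant_on_def)
  then show ?thesis using q(2) by (simp add: pathstart_def pathfinish_def algebra_simps)
qed

text \<open>The four terms are the changes of a logarithm of \<open>\<gamma> s - \<delta> t\<close>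
  along the sides of the unit square.\<close>
lemma winding_number_disjoint_paths:
  assumes g: "path \<gamma>" "path \<delta>" and disj: "path_image \<gamma> \<inter> path_image \<delta> = {}"
  shows "winding_number \<gamma> (pathstart \<delta>) - winding_number \<gamma> (pathfinish \<delta>)
       = winding_number \<delta> (pathstart \<gamma>) - winding_number \<delta> (pathfinish \<gamma>)"
proof -
  let ?S = "{0..1} \<times> {0..1} :: (real \<times> real) set"
  have cg: "continuous_on {0..1} \<gamma>" "continuous_on {0..1} \<delta>" using g by (auto simp: path_def)
  have "continuous_on ?S (\<lambda>x. \<gamma> (fst x) - \<delta> (snd x))"
    by (intro continuous_intros continuous_on_compose2[OF cg(1)] continuous_on_compose2[OF cg(2)]) auto
  moreover have "contractible ?S" by (intro convex_imp_contractible convex_Times) auto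
  moreover have "\<gamma> (fst x) - \<delta> (snd x) \<noteq> 0" if "x \<in> ?S" for x
  proof -
    have "\<gamma> (fst x) \<in> path_image \<gamma>" "\<delta> (snd x) \<in> path_image \<delta>"
      using that by (auto simp: path_image_def)
    then show ?thesis using disj by auto
  qed
  ultimately obtain H where H: "continuous_on ?S H" "\<And>x. x \<in> ?S \<Longrightarrow> \<gamma> (fst x) - \<delta> (snd x) = exp (H x)"
    using continuous_logarithm_on_contractible by (metis (no_types, lifting))
  have A: "H (1, t) - H (0, t) = 2 * of_real pi * \<i> * winding_number \<gamma> (\<delta> t)" if "t \<in> {0..1}" for t
  proof (rule winding_number_log[OF g(1), of _ "\<lambda>s. H (s, t)"])
    show "\<delta> t \<notin> path_image \<gamma>" using that disj by (force simp: path_image_def)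
    show "continuous_on {0..1} (\<lambda>s. H (s, t))"
      by (intro continuous_on_compose2[OF H(1)] continuous_intros) (use that in auto)
    show "\<gamma> s - \<delta> t = exp (H (s, t))" if "s \<in> {0..1}" for s
      using H(2)[of "(s, t)"] that \<open>t \<in> {0..1}\<close> by auto
  qed
  have B: "H (s, 1) - H (s, 0) = 2 * of_real pi * \<i> * winding_number \<delta> (\<gamma> s)" if "s \<in> {0..1}" for s
  proof -
    \<comment> \<open>Adding the constant \<open>\<i> * pi\<close> turns a logarithm of \<gamma> s -
      \<delta> t into one of \<delta> t - \<gamma> s without affecting increments.\<close>
    have "(H (s, 1) + \<i> * pi) - (H (s, 0) + \<i> * pi) = 2 * of_real pi * \<i> * winding_number \<delta> (\<gamma> s)"
    proof (rule winding_number_log[OF g(2), of _ "\<lambda>t. H (s, t) + \<i> * pi"])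
      show "\<gamma> s \<notin> path_image \<delta>" using that disj by (force simp: path_image_def)
      show "continuous_on {0..1} (\<lambda>t. H (s, t) + \<i> * pi)"
        by (intro continuous_intros continuous_on_compose2[OF H(1)]) (use that in auto)
      show "\<delta> t - \<gamma> s = exp (H (s, t) + \<i> * pi)" if "t \<in> {0..1}" for t
        using H(2)[of "(s, t)", symmetric] that \<open>s \<in> {0..1}\<close> by (simp add: exp_add)
    qed
    then show ?thesis by simp
  qed
  have "2 * of_real pi * \<i> * (winding_number \<gamma> (\<delta> 0) - winding_number \<gamma> (\<delta> 1))
      = 2 * of_real pi * \<i> * (winding_number \<delta> (\<gamma> 0) - winding_number \<delta> (\<gamma> 1))"
  proof -
    have "(H (1, 0) - H (0, 0)) - (H (1, 1) - H (0, 1)) = (H (0, 1) - H (0, 0)) - (H (1, 1) - H (1, 0))"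
      by simp
    then show ?thesis using A[of 0] A[of 1] B[of 0] B[of 1] by (simp add: right_diff_distrib)
  qed
  then show ?thesis by (simp add: pathstart_def pathfinish_def)
qed

text \<open>Non-planarity of \<open>K\<^sub>3\<^sub>,\<^sub>3\<close> as a parity obstruction: fixing
  logarithms of all differences of the six points, each crossing relation becomes an equation
  between integers, and the eighteen equations add up to an odd number being even.\<close>
lemma K33_winding_obstruction:
  fixes r b :: "nat \<Rightarrow> complex" and W :: "complex \<Rightarrow> complex \<Rightarrow> complex \<Rightarrow> complex"
  assumes r: "inj_on r {..<3}" and b: "inj_on b {..<3}"
    and rb: "\<And>i j. i < 3 \<Longrightarrow> j < 3 \<Longrightarrow> r i \<noteq> b j"
    and Wr: "\<And>i j k. \<lbrakk>i < 3; j < 3; k < 3; i \<noteq> k\<rbrakk> \<Longrightarrow>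
      b j - r k = exp (2 * of_real pi * \<i> * W (r i) (b j) (r k)) * (r i - r k)"
    and Wb: "\<And>i j l. \<lbrakk>i < 3; j < 3; l < 3; j \<noteq> l\<rbrakk> \<Longrightarrow>
      b j - b l = exp (2 * of_real pi * \<i> * W (r i) (b j) (b l)) * (r i - b l)"
    and rel: "\<And>i j k l. \<lbrakk>i < 3; j < 3; k < 3; l < 3; i \<noteq> k; j \<noteq> l\<rbrakk> \<Longrightarrow>
      W (r i) (b j) (r k) - W (r i) (b j) (b l) = W (r k) (b l) (r i) - W (r k) (b l) (b j)"
  shows False
proof -
  \<comment> \<open>One logarithm is chosen per unordered pair, so that reversing a difference
    changes it by exactly a half turn, with sign fixed by the order of the indices.\<close>
  define lg where "lg f i k = (if i < k then Ln (f i - f k) else Ln (f k - f i) + \<i> * of_real pi)"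
    for f :: "nat \<Rightarrow> complex" and i k :: nat
  define A where "A k j = Ln (b j - r k)" for k j
  have lg: "exp (lg f i k) = f i - f k" if "inj_on f {..<3}" "i < 3" "k < 3" "i \<noteq> k" for f i k
  proof -
    have "f i \<noteq> f k" using that by (auto dest: inj_onD)
    then show ?thesis by (auto simp: lg_def exp_add)
  qed
  have eA: "exp (A k j) = b j - r k" "exp (A k j + \<i> * of_real pi) = r k - b j" if "k < 3" "j < 3" for k j
    using rb[OF that] by (auto simp: A_def exp_add)
  have "\<exists>m::int. 2 * of_real pi * \<i> * W (r i) (b j) (r k) = A k j - lg r i k + of_int (2 * m) * of_real pi * \<i>"
    if "i < 3" "j < 3" "k < 3" "i \<noteq> k" for i j k
  proof -
    have "exp (2 * of_real pi * \<i> * W (r i) (b j) (r k)) = exp (A k j - lg r i k)"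
      using Wr[OF that] unfolding eA(1)[OF that(3,2), symmetric] lg[OF r that(1,3,4), symmetric]
      by (simp add: exp_diff)
    then show ?thesis by (simp only: exp_eq of_real_mult of_real_of_int_eq)
  qed
  then obtain m :: "nat \<Rightarrow> nat \<Rightarrow> nat \<Rightarrow> int" where m: "\<And>i j k. \<lbrakk>i < 3; j < 3; k < 3; i \<noteq> k\<rbrakk> \<Longrightarrow>
    2 * of_real pi * \<i> * W (r i) (b j) (r k) = A k j - lg r i k + of_int (2 * m i j k) * of_real pi * \<i>"
    by metis
  have "\<exists>n::int. 2 * of_real pi * \<i> * W (r i) (b j) (b l)
      = lg b j l - (A i l + \<i> * of_real pi) + of_int (2 * n) * of_real pi * \<i>"
    if "i < 3" "j < 3" "l < 3" "j \<noteq> l" for i j l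
  proof -
    have "exp (2 * of_real pi * \<i> * W (r i) (b j) (b l)) = exp (lg b j l - (A i l + \<i> * of_real pi))"
      using Wb[OF that] unfolding eA(2)[OF that(1,3), symmetric] lg[OF b that(2,3,4), symmetric]
        exp_diff by simp
    then show ?thesis by (simp only: exp_eq of_real_mult of_real_of_int_eq)
  qed
  then obtain n :: "nat \<Rightarrow> nat \<Rightarrow> nat \<Rightarrow> int" where n: "\<And>i j l. \<lbrakk>i < 3; j < 3; l < 3; j \<noteq> l\<rbrakk> \<Longrightarrow>
    2 * of_real pi * \<i> * W (r i) (b j) (b l)
      = lg b j l - (A i l + \<i> * of_real pi) + of_int (2 * n i j l) * of_real pi * \<i>"
    by metis
  \<comment> \<open>The logarithms \<open>A\<close> cancel. As \<open>i < k\<close>, the half turns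
    left over from \<open>lg\<close> make a full turn if \<open>j < l\<close> and cancel if
    \<open>l < j\<close>.\<close>
  have key: "(if j < l then 1 else 0) + m i j k - n i j l - m k l i + n k l j = 0"
    if "i < k" "j < 3" "k < 3" "l < 3" "j \<noteq> l" for i j k l
  proof -
    have i: "i < 3" "i \<noteq> k" "k \<noteq> i" "l \<noteq> j" using that by auto
    have "2 * of_real pi * \<i> * (W (r i) (b j) (r k) - W (r i) (b j) (b l))
        = 2 * of_real pi * \<i> * (W (r k) (b l) (r i) - W (r k) (b l) (b j))"
      using rel[of i j k l] that i by simp
    then have "(lg r k i - lg r i k) + (lg b l j - lg b j l)
        + of_int (2 * (m i j k - n i j l - m k l i + n k l j)) * of_real pi * \<i> = 0"
      unfolding right_diff_distrib
        m[OF i(1) that(2,3) i(2)] m[OF that(3,4) i(1) i(3)]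
        n[OF i(1) that(2,4,5)] n[OF that(3,4,2) i(4)]
      by (simp add: algebra_simps)
    moreover have "lg r k i - lg r i k = \<i> * of_real pi" using that by (simp add: lg_def)
    moreover have "lg b l j - lg b j l = (if j < l then 1 else -1) * \<i> * of_real pi"
      using that by (auto simp: lg_def)
    ultimately have "of_int (2 * ((if j < l then 1 else 0) + m i j k - n i j l - m k l i + n k l j))
        * (of_real pi * \<i>) = (0::complex)"
      by (simp add: algebra_simps split: if_splits)
    then show ?thesis by (simp del: of_int_mult of_int_add of_int_diff)
  qed
  have key1: "1 + m i j k - n i j l - m k l i + n k l j = 0" if "i < k" "k < 3" "j < l" "l < 3" for i j k l
    using key[of i k j l] that by simp
  have key2: "m i j k - n i j l - m k l i + n k l j = 0" if "i < k" "k < 3" "l < j" "j < 3" for i j k l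
    using key[of i k j l] that by simp
  define M where "M i k = m i 0 k + m i 1 k + m i 2 k" for i k
  define N where "N i = n i 0 1 + n i 0 2 + n i 1 0 + n i 1 2 + n i 2 0 + n i 2 1" for i
  \<comment> \<open>In the sum over all ordered \<open>j\<close>, \<open>l\<close>, three of the six
    equations contribute 1, each \<open>m\<close> term occurs for two choices of the absent index,
    and each \<open>n\<close> term occurs once.\<close>
  have six: "3 + 2 * M i k - 2 * M k i - N i + N k = 0" if "i < k" "k < 3" for i k
  proof -
    have "(0::nat) < 1" "(1::nat) < 2" "(0::nat) < 2" "(1::nat) < 3" "(2::nat) < 3" by auto
    note key1[OF that this(1,4)] key1[OF that this(2,5)] key1[OF that this(3,5)]
      key2[OF that this(1,4)] key2[OF that this(2,5)] key2[OF that this(3,5)]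
    then show ?thesis unfolding M_def N_def by algebra
  qed
  \<comment> \<open>Modulo 2, the three integers \<open>N 0\<close>, \<open>N 1\<close>,
    \<open>N 2\<close> would have pairwise different parities.\<close>
  have "3 + 2 * M 0 1 - 2 * M 1 0 - N 0 + N 1 = 0" "3 + 2 * M 0 2 - 2 * M 2 0 - N 0 + N 2 = 0"
    "3 + 2 * M 1 2 - 2 * M 2 1 - N 1 + N 2 = 0"
    by (rule six; simp)+
  then show False by presburger
qed

subsection \<open>Double counting\<close>

text \<open>Triples are ordered and distinctness is a 0/1 factor, so permuting the entries is an
  interchange of sums.\<close>

definition distinct3_sum :: "'a set \<Rightarrow> ('a \<Rightarrow> 'a \<Rightarrow> 'a \<Rightarrow> nat) \<Rightarrow> nat" where
  "distinct3_sum A F = (\<Sum>x\<in>A. \<Sum>y\<in>A. \<Sum>z\<in>A. of_bool (distinct [x, y, z]) * F x y z)"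

definition distinct2_sum :: "'a set \<Rightarrow> ('a \<Rightarrow> 'a \<Rightarrow> nat) \<Rightarrow> nat" where
  "distinct2_sum A f = (\<Sum>x\<in>A. \<Sum>y\<in>A. of_bool (x \<noteq> y) * f x y)"

definition pairs3 :: "'a \<Rightarrow> 'a \<Rightarrow> 'a \<Rightarrow> ('a \<Rightarrow> 'a \<Rightarrow> nat) \<Rightarrow> nat" where
  "pairs3 x y z f = f x y + f y x + f x z + f z x + f y z + f z y"

lemma distinct3_sum_swap23: "distinct3_sum A F = distinct3_sum A (\<lambda>x y z. F x z y)"
  unfolding distinct3_sum_def
  by (subst (2) sum.swap) (intro sum.cong refl arg_cong2[where f = "(*)"], auto)

lemma distinct3_sum_swap12: "distinct3_sum A F = distinct3_sum A (\<lambda>x y z. F y x z)"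
  unfolding distinct3_sum_def
  by (subst sum.swap) (intro sum.cong refl arg_cong2[where f = "(*)"], auto)

lemma distinct2_sum_swap: "distinct2_sum A (\<lambda>x y. f y x) = distinct2_sum A f"
  unfolding distinct2_sum_def
  by (subst sum.swap) (intro sum.cong refl arg_cong2[where f = "(*)"], auto)

lemma distinct3_sum_add:
  "distinct3_sum A (\<lambda>x y z. F x y z + G x y z) = distinct3_sum A F + distinct3_sum A G"
  by (simp add: distinct3_sum_def distrib_left sum.distrib)

lemma distinct3_sum_first_two:
  assumes "finite A"
  shows "distinct3_sum A (\<lambda>x y z. f x y) = (card A - 2) * distinct2_sum A f"
proof -
  have "(\<Sum>z\<in>A. of_bool (distinct [x, y, z]) * f x y) = (card A - 2) * (of_bool (x \<noteq> y) * f x y)"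
    if "x \<in> A" "y \<in> A" for x y
  proof (cases "x = y")
    case False
    have "(\<Sum>z\<in>A. of_bool (distinct [x, y, z]) * f x y) = (\<Sum>z\<in>A - {x, y}. f x y)"
      using False assms by (intro sum.mono_neutral_cong_right) auto
    also have "\<dots> = (card A - 2) * f x y"
      using False assms that by (simp add: card_Diff_subset numeral_2_eq_2)
    finally show ?thesis using False by simp
  qed simp
  then show ?thesis
    by (simp add: distinct3_sum_def distinct2_sum_def sum_distrib_left)
qed

text \<open>An ordered pair of distinct elements can occupy six pairs of positions in a triple, and
  the remaining entry is free in \<open>card A - 2\<close> ways.\<close>

lemma distinct3_sum_pairs3:
  assumes "finite A"
  shows "distinct3_sum A (\<lambda>x y z. pairs3 x y z f) = 6 * (card A - 2) * distinct2_sum A f"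
proof -
  note base = distinct3_sum_first_two[OF assms]
  have 1: "distinct3_sum A (\<lambda>x y z. g x z) = (card A - 2) * distinct2_sum A g" for g
    using distinct3_sum_swap23[of A "\<lambda>x y z. g x y"] base[of g] by simp
  have 2: "distinct3_sum A (\<lambda>x y z. g y z) = (card A - 2) * distinct2_sum A g" for g
    using distinct3_sum_swap12[of A "\<lambda>x y z. g x z"] 1[of g] by simp
  show ?thesis
    unfolding pairs3_def distinct3_sum_add
    using base[of f] 1[of f] 2[of f] base[of "\<lambda>x y. f y x"] 1[of "\<lambda>x y. f y x"]
      2[of "\<lambda>x y. f y x"] distinct2_sum_swap[of A f]
    by simp
qed

lemma distinct2_sum_const:
  assumes "finite A"
  shows "distinct2_sum A (\<lambda>x y. 1) = card A * (card A - 1)"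
proof -
  have "(\<Sum>y\<in>A. of_bool (x \<noteq> y)) = card A - 1" if "x \<in> A" for x
  proof -
    have "(\<Sum>y\<in>A. of_bool (x \<noteq> y) :: nat) = (\<Sum>y\<in>A - {x}. 1)"
      using assms by (intro sum.mono_neutral_cong_right) auto
    then show ?thesis using that assms by simp
  qed
  then show ?thesis by (simp add: distinct2_sum_def)
qed

lemma distinct3_sum_mono:
  assumes "\<And>x y z. \<lbrakk>x \<in> A; y \<in> A; z \<in> A; distinct [x, y, z]\<rbrakk> \<Longrightarrow> F x y z \<le> G x y z"
  shows "distinct3_sum A F \<le> distinct3_sum A G"
  unfolding distinct3_sum_def using assms by (intro sum_mono) (auto simp: of_bool_def)

lemma distinct3_sum_mult_right: "distinct3_sum A (\<lambda>x y z. c * F x y z) = c * distinct3_sum A F"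
  by (simp add: distinct3_sum_def sum_distrib_left mult.left_commute)

lemma distinct2_sum_mult_right: "distinct2_sum A (\<lambda>x y. c * f x y) = c * distinct2_sum A f"
  by (simp add: distinct2_sum_def sum_distrib_left mult.left_commute)

lemma distinct3_sum_pairs3_swap:
  "distinct3_sum A (\<lambda>u v w. pairs3 x y z (\<lambda>s t. G s t u v w)) = pairs3 x y z (\<lambda>s t. distinct3_sum A (G s t))"
  by (simp add: pairs3_def distinct3_sum_add)

text \<open>Averaging: there are \<open>(m * (m - 1) * (m - 2))\<^sup>2\<close> choices of two
  ordered triples, each containing an instance of \<open>Q\<close>, and each instance is counted
  \<open>(6 * (m - 2))\<^sup>2\<close> times. Hence the \<open>m\<^sup>2\<close> pairs
  \<open>r\<close>, \<open>b\<close> share at least \<open>m\<^sup>2 * (m - 1)\<^sup>2 / 36\<close>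
  instances.\<close>

lemma popular_pair:
  fixes Q :: "'a \<Rightarrow> 'b \<Rightarrow> 'a \<Rightarrow> 'b \<Rightarrow> bool"
  assumes fin: "finite R" "finite B" and card: "card R = m" "card B = m" "m \<ge> 3"
    and Q: "\<And>x y z u v w. \<lbrakk>{x, y, z} \<subseteq> R; distinct [x, y, z]; {u, v, w} \<subseteq> B; distinct [u, v, w]\<rbrakk> \<Longrightarrow>
      1 \<le> pairs3 x y z (\<lambda>s t. pairs3 u v w (\<lambda>p q. of_bool (Q s p t q)))"
  shows "\<exists>r\<in>R. \<exists>b\<in>B. (m - 1)\<^sup>2 \<le> 36 * card {(r', b') \<in> (R - {r}) \<times> (B - {b}). Q r b r' b'}"
proof -
  define N where "N s t = distinct2_sum B (\<lambda>p q. of_bool (Q s p t q))" for s t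
  let ?c = "6 * (m - 2)"
  have one: "distinct3_sum A (\<lambda>_ _ _. 1) = (m - 2) * (m * (m - 1))" if "finite A" "card A = m" for A :: "'c set"
    using distinct3_sum_first_two[of A "\<lambda>_ _. 1"] distinct2_sum_const[of A] that by simp
  have "((m - 2) * (m * (m - 1)))\<^sup>2 = distinct3_sum R (\<lambda>_ _ _. distinct3_sum B (\<lambda>_ _ _. 1))"
    using distinct3_sum_mult_right[of R "distinct3_sum B (\<lambda>_ _ _. 1)" "\<lambda>_ _ _. 1"]
      one[OF fin(1) card(1)] one[OF fin(2) card(2)] by (simp add: power2_eq_square)
  also have "\<dots> \<le> distinct3_sum R (\<lambda>x y z. distinct3_sum B (\<lambda>u v w.
      pairs3 x y z (\<lambda>s t. pairs3 u v w (\<lambda>p q. of_bool (Q s p t q)))))"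
    by (intro distinct3_sum_mono Q) auto
  also have "\<dots> = distinct3_sum R (\<lambda>x y z. pairs3 x y z (\<lambda>s t. ?c * N s t))"
    by (simp only: distinct3_sum_pairs3_swap distinct3_sum_pairs3[OF fin(2)] N_def card(2))
  also have "\<dots> = ?c * (?c * distinct2_sum R N)"
    by (simp only: distinct3_sum_pairs3[OF fin(1)] distinct2_sum_mult_right card(1))
  finally have "(m - 2)\<^sup>2 * (m\<^sup>2 * (m - 1)\<^sup>2) \<le> (m - 2)\<^sup>2 * (36 * distinct2_sum R N)"
    by (simp add: power2_eq_square mult_ac)
  then have le: "m\<^sup>2 * (m - 1)\<^sup>2 \<le> 36 * distinct2_sum R N" using card(3) by simp
  define w where "w r b = card {(r', b') \<in> (R - {r}) \<times> (B - {b}). Q r b r' b'}" for r b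
  have w: "w r b = (\<Sum>t\<in>R. \<Sum>q\<in>B. of_bool (r \<noteq> t) * (of_bool (b \<noteq> q) * of_bool (Q r b t q)))" for r b
  proof -
    have "(\<Sum>t\<in>R. \<Sum>q\<in>B. of_bool (r \<noteq> t) * (of_bool (b \<noteq> q) * of_bool (Q r b t q)))
        = (\<Sum>x\<in>R \<times> B. of_bool (r \<noteq> fst x \<and> b \<noteq> snd x \<and> Q r b (fst x) (snd x)) :: nat)"
      by (simp add: sum.cartesian_product case_prod_unfold of_bool_conj)
    also have "\<dots> = (\<Sum>x\<in>{(r', b') \<in> (R - {r}) \<times> (B - {b}). Q r b r' b'}. 1)"
      using fin by (intro sum.mono_neutral_cong_right) auto
    finally show ?thesis by (simp add: w_def)
  qed
  have "distinct2_sum R N = (\<Sum>r\<in>R. \<Sum>t\<in>R. \<Sum>b\<in>B. \<Sum>q\<in>B. of_bool (r \<noteq> t) * (of_bool (b \<noteq> q) * of_bool (Q r b t q)))"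
    by (simp add: distinct2_sum_def N_def sum_distrib_left)
  also have "\<dots> = (\<Sum>r\<in>R. \<Sum>b\<in>B. w r b)"
    unfolding w by (intro sum.cong refl sum.swap)
  finally have tot: "distinct2_sum R N = (\<Sum>r\<in>R. \<Sum>b\<in>B. w r b)" .
  show ?thesis
  proof (rule ccontr)
    assume "\<not> ?thesis"
    then have lt: "36 * w r b < (m - 1)\<^sup>2" if "r \<in> R" "b \<in> B" for r b
      using that by (auto simp: w_def not_le)
    have ne: "R \<noteq> {}" "B \<noteq> {}" using card by auto
    have "36 * distinct2_sum R N = (\<Sum>r\<in>R. \<Sum>b\<in>B. 36 * w r b)"
      unfolding tot by (simp add: sum_distrib_left)
    also have "\<dots> < (\<Sum>r\<in>R. \<Sum>b\<in>B. (m - 1)\<^sup>2)"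
      by (intro sum_strict_mono fin ne lt)
    also have "\<dots> = m\<^sup>2 * (m - 1)\<^sup>2" by (simp add: card power2_eq_square)
    finally show False using le by simp
  qed
qed

text \<open>Each point of \<open>I\<close> lies in at most \<open>m - 1\<close> pairs of
  \<open>W\<close>, and \<open>I\<close> meets all of them, so \<open>card W\<close> is at most
  \<open>(m - 1) * card I\<close>.\<close>

lemma cover_bound:
  assumes fin: "finite R" "finite B" and disj: "R \<inter> B = {}" and card: "card R = m" "card B = m" "m \<ge> 2"
    and rb: "r \<in> R" "b \<in> B" and W: "(m - 1)\<^sup>2 \<le> 36 * card W" "W \<subseteq> (R - {r}) \<times> (B - {b})"
    and I: "I \<subseteq> R \<union> B" "\<And>r' b'. (r', b') \<in> W \<Longrightarrow> r' \<in> I \<or> b' \<in> I"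
  shows "m - 1 \<le> 36 * card I"
proof -
  have "W \<subseteq> (I \<inter> R) \<times> (B - {b}) \<union> (R - {r}) \<times> (I \<inter> B)" using W(2) I(2) by auto
  then have "card W \<le> card ((I \<inter> R) \<times> (B - {b}) \<union> (R - {r}) \<times> (I \<inter> B))"
    using fin by (intro card_mono) auto
  also have "\<dots> \<le> card ((I \<inter> R) \<times> (B - {b})) + card ((R - {r}) \<times> (I \<inter> B))" by (rule card_Un_le)
  also have "\<dots> = (m - 1) * (card (I \<inter> R) + card (I \<inter> B))"
    using rb card fin by (simp add: card_cartesian_product algebra_simps)
  also have "card (I \<inter> R) + card (I \<inter> B) = card (I \<inter> R \<union> I \<inter> B)"
    using fin disj by (subst card_Un_disjoint) auto
  also have "I \<inter> R \<union> I \<inter> B = I" using I(1) by auto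
  finally have "36 * card W \<le> 36 * ((m - 1) * card I)" by simp
  with W(1) have "(m - 1) * (m - 1) \<le> (m - 1) * (36 * card I)"
    unfolding power2_eq_square by linarith
  then show ?thesis using card(3) by simp
qed

subsection \<open>Pairs forcing other pairs into their disks\<close>

text \<open>A disk through \<open>a\<close> and \<open>b\<close> is encoded by its centre
  \<open>c\<close>; the radius is the common distance.\<close>

definition forces :: "complex set \<Rightarrow> complex \<Rightarrow> complex \<Rightarrow> complex \<Rightarrow> complex \<Rightarrow> bool" where
  "forces P a b a' b' \<longleftrightarrow> (\<forall>c\<in>P. gdist P c a = gdist P c b \<longrightarrow>
     gdist P c a' \<le> gdist P c a \<or> gdist P c b' \<le> gdist P c a)"

context geodesic_region
begin

lemma K33_forces:
  fixes r b :: "nat \<Rightarrow> complex"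
  assumes r: "inj_on r {..<3}" "r ` {..<3} \<subseteq> P" and b: "inj_on b {..<3}" "b ` {..<3} \<subseteq> P"
    and rb: "\<And>i j. i < 3 \<Longrightarrow> j < 3 \<Longrightarrow> r i \<noteq> b j"
  shows "\<exists>i<3. \<exists>j<3. \<exists>k<3. \<exists>l<3. i \<noteq> k \<and> j \<noteq> l \<and> forces P (r i) (b j) (r k) (b l)"
proof (rule ccontr)
  assume neg: "\<not> ?thesis"
  \<comment> \<open>By uniqueness the chosen path does not matter, so \<open>W\<close> is a function
    of the endpoints and the point alone, as the obstruction requires.\<close>
  define W where "W a c p = winding_number (SOME \<gamma>. nearer_path a c p \<gamma>) p" for a c p
  have W: "winding_number \<gamma> p = W a c p" if "nearer_path a c p \<gamma>" "p \<in> P" for a c p \<gamma>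
    unfolding W_def by (rule winding_number_nearer_path_unique[OF that(1) someI[of "nearer_path a c p", OF that(1)] that(2)])
  have mem: "r i \<in> P" "b i \<in> P" if "i < 3" for i using r(2) b(2) that by auto
  have ex: "\<exists>\<gamma>. nearer_path (r i) (b j) (r k) \<gamma> \<and> nearer_path (r i) (b j) (b l) \<gamma>"
    if idx: "i < 3" "j < 3" "k < 3" "l < 3" "i \<noteq> k" "j \<noteq> l" for i j k l
  proof -
    have "\<not> forces P (r i) (b j) (r k) (b l)" using neg idx by blast
    then obtain c where c: "c \<in> P" "gdist P c (r i) = gdist P c (b j)"
      "gdist P c (r i) < gdist P c (r k)" "gdist P c (r i) < gdist P c (b l)"
      by (auto simp: forces_def not_le)
    obtain \<gamma> where g: "\<And>p. p \<in> P \<Longrightarrow> min (gdist P c (r k)) (gdist P c (b l)) \<le> gdist P c p \<Longrightarrow>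
        nearer_path (r i) (b j) p \<gamma>"
      using nearer_path_through_centre[OF c(1) mem(1)[OF idx(1)] mem(2)[OF idx(2)] refl c(2)[symmetric],
        of "min (gdist P c (r k)) (gdist P c (b l))"] c by auto
    show ?thesis using g[of "r k"] g[of "b l"] mem idx by auto
  qed
  have expW: "c - p = exp (2 * of_real pi * \<i> * W a c p) * (a - p)"
    if "nearer_path a c p \<gamma>" "p \<in> P" for a c p \<gamma>
    using winding_number_exp_2pi[of \<gamma> p] nearer_path_avoids[OF that] W[OF that] that(1)
    by (auto simp: nearer_path_def)
  \<comment> \<open>The exponential relations mention three indices only, whereas \<open>ex\<close>
    asks for a fourth; any admissible one will do.\<close>
  have other: "\<exists>l<3. j \<noteq> l" for j :: nat
    by (rule exI[of _ "if j = 0 then 1 else 0"]) auto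
  show False
  proof (rule K33_winding_obstruction[OF r(1) b(1) rb, where W = W])
    fix i j k :: nat assume "i < 3" "j < 3" "k < 3" "i \<noteq> k"
    then show "b j - r k = exp (2 * of_real pi * \<i> * W (r i) (b j) (r k)) * (r i - r k)"
      using ex[of i j k] expW mem(1) other[of j] by metis
  next
    fix i j l :: nat assume "i < 3" "j < 3" "l < 3" "j \<noteq> l"
    then show "b j - b l = exp (2 * of_real pi * \<i> * W (r i) (b j) (b l)) * (r i - b l)"
      using ex[of i j _ l] expW mem(2) other[of i] by metis
  next
    fix i j k l :: nat assume *: "i < 3" "j < 3" "k < 3" "l < 3" "i \<noteq> k" "j \<noteq> l"
    obtain \<gamma> where g: "nearer_path (r i) (b j) (r k) \<gamma>" "nearer_path (r i) (b j) (b l) \<gamma>"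
      using ex[OF *] by blast
    obtain \<delta> where d: "nearer_path (r k) (b l) (r i) \<delta>" "nearer_path (r k) (b l) (b j) \<delta>"
      using ex[of k l i j] * by blast
    \<comment> \<open>A common point would be strictly nearer to each pair than to the
      other.\<close>
    have "path_image \<gamma> \<inter> path_image \<delta> = {}"
    proof (rule equals0I)
      fix x assume "x \<in> path_image \<gamma> \<inter> path_image \<delta>"
      then have "min (gdist P x (r i)) (gdist P x (b j)) < min (gdist P x (r k)) (gdist P x (b l))"
        "min (gdist P x (r k)) (gdist P x (b l)) < min (gdist P x (r i)) (gdist P x (b j))"
        using g d by (auto simp: nearer_path_def)
      then show False by (rule less_asym)
    qed
    moreover have "path \<gamma>" "path \<delta>" "pathstart \<gamma> = r i" "pathfinish \<gamma> = b j" "pathstart \<delta> = r k" "pathfinish \<delta> = b l"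
      using g d by (auto simp: nearer_path_def)
    ultimately have "winding_number \<gamma> (r k) - winding_number \<gamma> (b l) = winding_number \<delta> (r i) - winding_number \<delta> (b j)"
      using winding_number_disjoint_paths[of \<gamma> \<delta>] by simp
    then show "W (r i) (b j) (r k) - W (r i) (b j) (b l) = W (r k) (b l) (r i) - W (r k) (b l) (b j)"
      using W[OF g(1)] W[OF g(2)] W[OF d(1)] W[OF d(2)] mem * by simp
  qed
qed

lemma forces_pairs3:
  assumes "{x, y, z} \<subseteq> P" "distinct [x, y, z]" "{u, v, w} \<subseteq> P" "distinct [u, v, w]"
    and "{x, y, z} \<inter> {u, v, w} = {}"
  shows "1 \<le> pairs3 x y z (\<lambda>s t. pairs3 u v w (\<lambda>p q. of_bool (forces P s p t q)))"
proof -
  define r b where "r = (!) [x, y, z]" and "b = (!) [u, v, w]"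
  have three: "{..<3} = {0, 1, 2 :: nat}" by auto
  have lt: "i < 3 \<longleftrightarrow> i = 0 \<or> i = 1 \<or> i = 2" for i :: nat by auto
  have "\<exists>i<3. \<exists>j<3. \<exists>k<3. \<exists>l<3. i \<noteq> k \<and> j \<noteq> l \<and> forces P (r i) (b j) (r k) (b l)"
  proof (rule K33_forces)
    show "inj_on r {..<3}" "inj_on b {..<3}" "r ` {..<3} \<subseteq> P" "b ` {..<3} \<subseteq> P"
      using assms by (auto simp: three r_def b_def inj_on_def)
    show "r i \<noteq> b j" if "i < 3" "j < 3" for i j
      using that assms(5) unfolding lt by (auto simp: r_def b_def)
  qed
  then obtain i j k l where *: "i < 3" "j < 3" "k < 3" "l < 3" "i \<noteq> k" "j \<noteq> l" "forces P (r i) (b j) (r k) (b l)"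
    by blast
  have pos: "1 \<le> pairs3 (f 0) (f 1) (f 2) F" if "i < 3" "k < 3" "i \<noteq> k" "1 \<le> F (f i) (f k)"
    for f :: "nat \<Rightarrow> complex" and F i k
    using that unfolding lt pairs3_def by auto
  have "1 \<le> pairs3 (b 0) (b 1) (b 2) (\<lambda>p q. of_bool (forces P (r i) p (r k) q))"
    by (rule pos[where f = b, OF *(2,4,6)]) (use *(7) in simp)
  then have "1 \<le> pairs3 (r 0) (r 1) (r 2) (\<lambda>s t. pairs3 (b 0) (b 1) (b 2) (\<lambda>p q. of_bool (forces P s p t q)))"
    by (rule pos[where f = r, OF *(1,3,5)])
  then show ?thesis by (simp add: r_def b_def)
qed

end

theorem theorem8:
  fixes n :: nat and vs :: "complex list" and R B :: "complex set"
  assumes "even n" and "n \<ge> 6"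
    and "simple_polygon vs"
    and "R \<inter> B = {}" and "card R = n div 2" and "card B = n div 2"
    and "R \<union> B \<subseteq> polygon_region vs"
    and "general_position vs (R \<union> B)"
  shows "\<exists>r\<in>R. \<exists>b\<in>B. \<forall>c\<in>polygon_region vs. \<forall>\<rho>::real.
           gdist (polygon_region vs) c r = \<rho> \<and> gdist (polygon_region vs) c b = \<rho> \<longrightarrow>
           int (card {s \<in> R \<union> B. gdist (polygon_region vs) c s \<le> \<rho>})
             \<ge> \<lceil>(real n - 2) / 72\<rceil>"
proof -
  let ?P = "polygon_region vs"
  define m where "m = n div 2"
  have n: "n = 2 * m" "m \<ge> 3" using assms(1,2) by (auto simp: m_def)
  have card: "card R = m" "card B = m" using assms by (auto simp: m_def)
  then have fin: "finite R" "finite B" using n by (auto intro: card_ge_0_finite)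
  have "vs \<noteq> []" using assms(3) by (auto simp: simple_polygon_def)
  then interpret geodesic_region ?P by (rule geodesic_region_polygon)
  have "\<exists>r\<in>R. \<exists>b\<in>B. (m - 1)\<^sup>2 \<le> 36 * card {(r', b') \<in> (R - {r}) \<times> (B - {b}). forces ?P r b r' b'}"
  proof (rule popular_pair[OF fin card n(2)])
    fix x y z u v w
    assume "{x, y, z} \<subseteq> R" "distinct [x, y, z]" "{u, v, w} \<subseteq> B" "distinct [u, v, w]"
    then show "1 \<le> pairs3 x y z (\<lambda>s t. pairs3 u v w (\<lambda>p q. of_bool (forces ?P s p t q)))"
      using assms(4,7) by (intro forces_pairs3) auto
  qed
  then obtain r b where rb: "r \<in> R" "b \<in> B"
    and pop: "(m - 1)\<^sup>2 \<le> 36 * card {(r', b') \<in> (R - {r}) \<times> (B - {b}). forces ?P r b r' b'}"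
    by blast
  have "\<lceil>(real n - 2) / 72\<rceil> \<le> int (card {s \<in> R \<union> B. gdist ?P c s \<le> \<rho>})"
    if c: "c \<in> ?P" "gdist ?P c r = \<rho>" "gdist ?P c b = \<rho>" for c \<rho>
  proof -
    \<comment> \<open>The points of \<open>R \<union> B\<close> in the disk are the vertex cover of
      the forced pairs; with \<open>n = 2 * m\<close>, the factor 36 becomes 72.\<close>
    have "m - 1 \<le> 36 * card {s \<in> R \<union> B. gdist ?P c s \<le> \<rho>}"
    proof (rule cover_bound[OF fin assms(4) card _ rb pop])
      fix r' b' assume "(r', b') \<in> {(r', b') \<in> (R - {r}) \<times> (B - {b}). forces ?P r b r' b'}"
      then show "r' \<in> {s \<in> R \<union> B. gdist ?P c s \<le> \<rho>} \<or> b' \<in> {s \<in> R \<union> B. gdist ?P c s \<le> \<rho>}"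
        using c by (auto simp: forces_def)
    qed (use n in auto)
    then have "real n - 2 \<le> 72 * real (card {s \<in> R \<union> B. gdist ?P c s \<le> \<rho>})"
      using n by linarith
    then show ?thesis by (simp add: ceiling_le_iff)
  qed
  then show ?thesis using rb by blast
qed

end
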